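(* For every integer $n \geq 3$, the independence number of the cubical staircase graph $CS_n$ is $$\alpha(CS_n) = \begin{cases} \dfrac{n^3-3n^2+2n}{12}, & n \text{ even},\\[2mm] \dfrac{n^3-3n^2+5n-3}{12}, & n \text{ odd}.\end{cases}$$
   Context: For a natural number $n \geq 3$, the cubical staircase graph $CS_n$ is the graph with vertex set $\{(i,j,k) : 1 \leq i \leq n-2,\ 1 \leq j \leq i,\ 1 \leq k \leq n-1-i\}$ and edge set consisting of the pairs $(i,j,k)(i,j,k+1)$ for $1\le i\le n-2$, $1\le j\le i$, $1\le k\le n-2-i$; the pairs $(i,j,k)(i+1,j,k)$ for $1\le i\le n-3$, $1\le j\le i$, $1\le k\le n-1-i$; and the pairs $(i,j,k)(i,j+1,k)$ for $1\le i\le n-2$, $1\le j\le i-1$, $1\le k\le n-1-i$ (only pairs of vertices of $CS_n$ are included). The independence number $\alpha(G)$ is the maximum size of a set of pairwise non-adjacent vertices of $G$. *)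

theory Defs
  imports Complex_Main "HOL-Library.Ramsey"
begin

text \<open>
  Graphs are given by a vertex set and a set of two-element vertex sets, as in
  \<^const>\<open>indep\<close>, which says that a vertex set is pairwise non-adjacent.
\<close>

definition independence_number :: "'a set \<Rightarrow> 'a set set \<Rightarrow> nat" where
  "independence_number V E = Max (card ` {S. S \<subseteq> V \<and> indep S E})"

text \<open>
  The cubical staircase graph is meant for \<open>n \<ge> 3\<close>; in that case truncated subtraction
  on the naturals never gives a range of indices other than the integer one.
\<close>

definition CS_verts :: "nat \<Rightarrow> (nat \<times> nat \<times> nat) set" where
  "CS_verts n = {(i, j, k). 1 \<le> i \<and> i \<le> n - 2 \<and> 1 \<le> j \<and> j \<le> i \<and> 1 \<le> k \<and> k \<le> n - 1 - i}"

text \<open>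
  The intersection with \<^term>\<open>Pow (CS_verts n)\<close> matters: for \<open>k = n - 1 - i\<close> the triple
  \<open>(i + 1, j, k)\<close> in the second family is not a vertex.
\<close>

definition CS_edges :: "nat \<Rightarrow> (nat \<times> nat \<times> nat) set set" where
  "CS_edges n =
     ({{(i, j, k), (i, j, k + 1)} | i j k.
         1 \<le> i \<and> i \<le> n - 2 \<and> 1 \<le> j \<and> j \<le> i \<and> 1 \<le> k \<and> k \<le> n - 2 - i} \<union>
      {{(i, j, k), (i + 1, j, k)} | i j k.
         1 \<le> i \<and> i \<le> n - 3 \<and> 1 \<le> j \<and> j \<le> i \<and> 1 \<le> k \<and> k \<le> n - 1 - i} \<union>
      {{(i, j, k), (i, j + 1, k)} | i j k.
         1 \<le> i \<and> i \<le> n - 2 \<and> 1 \<le> j \<and> j \<le> i - 1 \<and> 1 \<le> k \<and> k \<le> n - 1 - i})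
     \<inter> Pow (CS_verts n)"

end

theory Submission
  imports Defs
begin

text \<open>
  The vertices with \<open>i + j + k\<close> odd form an independent set. For the converse bound, cover the
  vertices by disjoint edges and singletons: in the \<open>i \<times> (n - 1 - i)\<close> grid with first
  coordinate \<open>i\<close>, join the rows \<open>j = 1, 2\<close>, then \<open>j = 3, 4\<close>, and so on; if \<open>i\<close> is odd,
  tile the remaining row \<open>j = i\<close> by the edges \<open>k = 1, 2\<close>, then \<open>k = 3, 4\<close>, and so on.
  A singleton is left only for \<open>k = n - 1 - i\<close> odd, and then its coordinate sum is odd.
  Hence every block contains exactly one vertex of odd coordinate sum and at most one vertex
  of any given independent set.
\<close>

text \<open>The fibres of \<open>f\<close> are cliques, so \<open>f\<close> is injective on every
  independent set.\<close>

lemma card_indep_le: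
  assumes "finite P" "f ` V \<subseteq> P"
    and "\<And>u v. u \<in> V \<Longrightarrow> v \<in> V \<Longrightarrow> f u = f v \<Longrightarrow> u \<noteq> v \<Longrightarrow> {u, v} \<in> E"
    and "S \<subseteq> V" "indep S E"
  shows "card S \<le> card P"
proof (rule card_inj_on_le)
  show "inj_on f S"
    using assms(3-5) unfolding indep_def inj_on_def by (metis subsetD)
  show "f ` S \<subseteq> P"
    using assms(2,4) by blast
qed (fact assms(1))

lemma independence_number_eqI:
  assumes "finite V" "P \<subseteq> V" "indep P E"
    and "\<And>S. S \<subseteq> V \<Longrightarrow> indep S E \<Longrightarrow> card S \<le> card P"
  shows "independence_number V E = card P"
  unfolding independence_number_def
proof (rule Max_eqI)
  show "finite (card ` {S. S \<subseteq> V \<and> indep S E})"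
    using assms(1) by simp
qed (use assms in auto)

definition CS_odd :: "nat \<Rightarrow> (nat \<times> nat \<times> nat) set" where
  "CS_odd n = {(i, j, k) \<in> CS_verts n. odd (i + j + k)}"

text \<open>The partner of \<open>m\<close> in the pairing 1-2, 3-4, 5-6, and so on of the positive
  integers.\<close>

definition mate :: "nat \<Rightarrow> nat" where
  "mate m = (if odd m then m + 1 else m - 1)"

text \<open>The fibres on \<open>CS_verts n\<close> are the blocks of the cover: each vertex goes to
  the odd-sum vertex of its block. Singleton blocks fall under the first branch.\<close>

fun to_odd :: "nat \<times> nat \<times> nat \<Rightarrow> nat \<times> nat \<times> nat" where
  "to_odd (i, j, k) =
    (if odd (i + j + k) then (i, j, k)
     else if odd i \<and> j = i then (i, j, mate k) else (i, mate j, k))"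

lemma CS_verts_Sigma:
  "CS_verts n = (SIGMA i:{1..n - 2}. {1..i} \<times> {1..n - 1 - i})"
  unfolding CS_verts_def by auto

lemma finite_CS_verts: "finite (CS_verts n)"
  unfolding CS_verts_Sigma by auto

text \<open>Each edge raises exactly one coordinate by 1, so its ends have sums of opposite
  parity.\<close>

lemma indep_CS_odd: "indep (CS_odd n) (CS_edges n)"
  unfolding indep_def CS_odd_def CS_edges_def by (auto simp: doubleton_eq_iff)

lemma CS_edge_j:
  assumes "(i, j, k) \<in> CS_verts n" "(i, j + 1, k) \<in> CS_verts n"
  shows "{(i, j, k), (i, j + 1, k)} \<in> CS_edges n"
proof -
  have "1 \<le> i \<and> i \<le> n - 2 \<and> 1 \<le> j \<and> j \<le> i - 1 \<and> 1 \<le> k \<and> k \<le> n - 1 - i"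
    using assms unfolding CS_verts_def by auto
  then show ?thesis
    using assms unfolding CS_edges_def by blast
qed

lemma CS_edge_k:
  assumes "(i, j, k) \<in> CS_verts n" "(i, j, k + 1) \<in> CS_verts n"
  shows "{(i, j, k), (i, j, k + 1)} \<in> CS_edges n"
proof -
  have "1 \<le> i \<and> i \<le> n - 2 \<and> 1 \<le> j \<and> j \<le> i \<and> 1 \<le> k \<and> k \<le> n - 2 - i"
    using assms unfolding CS_verts_def by auto
  then show ?thesis
    using assms unfolding CS_edges_def by blast
qed

lemma mate_cases:
  assumes "m > 0"
  obtains "mate m = m + 1" "odd m" | "m = mate m + 1" "even m"
  using assms unfolding mate_def by (cases "odd m") auto

lemma mate_mate: "m > 0 \<Longrightarrow> mate (mate m) = m"
  unfolding mate_def by auto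

lemma even_mate: "m > 0 \<Longrightarrow> even (mate m) \<longleftrightarrow> odd m"
  unfolding mate_def by auto

lemma CS_edge_mate_j:
  assumes "(i, j, k) \<in> CS_verts n" "(i, mate j, k) \<in> CS_verts n"
  shows "{(i, j, k), (i, mate j, k)} \<in> CS_edges n"
proof -
  have "j > 0" using assms unfolding CS_verts_def by auto
  then show ?thesis
  proof (cases rule: mate_cases)
    case 1
    then show ?thesis
      using CS_edge_j[of i j k n] assms by simp
  next
    case 2
    then show ?thesis
      using CS_edge_j[of i "mate j" k n] assms by (simp add: insert_commute)
  qed
qed

lemma CS_edge_mate_k:
  assumes "(i, j, k) \<in> CS_verts n" "(i, j, mate k) \<in> CS_verts n"
  shows "{(i, j, k), (i, j, mate k)} \<in> CS_edges n"
proof -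
  have "k > 0" using assms unfolding CS_verts_def by auto
  then show ?thesis
  proof (cases rule: mate_cases)
    case 1
    then show ?thesis
      using CS_edge_k[of i j k n] assms by simp
  next
    case 2
    then show ?thesis
      using CS_edge_k[of i j "mate k" n] assms by (simp add: insert_commute)
  qed
qed

lemma to_odd_in_CS_odd:
  assumes "v \<in> CS_verts n"
  shows "to_odd v \<in> CS_odd n"
proof -
  obtain i j k where v: "v = (i, j, k)" by (metis prod_cases3)
  have b: "1 \<le> i" "i \<le> n - 2" "1 \<le> j" "j \<le> i" "1 \<le> k" "k \<le> n - 1 - i"
    using assms unfolding v CS_verts_def by auto
  consider "odd (i + j + k)" | "even (i + j + k)" "odd i" "j = i"
    | "even (i + j + k)" "\<not> (odd i \<and> j = i)" by blast
  then show ?thesis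
  proof cases
    case 1
    then show ?thesis using assms unfolding v CS_odd_def by simp
  next
    case 2
    \<comment> \<open>Here \<open>i + j = 2 * i\<close>, so \<open>k\<close> is even and
      \<open>mate k = k - 1\<close>: the upper bound on \<open>k\<close> cannot be exceeded.\<close>
    then have "even k" by simp
    then have "1 \<le> mate k" "mate k \<le> k" "odd (mate k)"
      using b unfolding mate_def by (auto elim: evenE)
    then show ?thesis using 2 b unfolding v CS_odd_def CS_verts_def by simp
  next
    case 3
    have "mate j \<le> i"
    proof (cases "odd j")
      case True
      \<comment> \<open>With \<open>j\<close> odd, \<open>j = i\<close> would make \<open>i\<close>
        odd, which is the excluded case; so \<open>j + 1\<close> still fits in the grid.\<close>
      then have "j \<noteq> i" using 3(2) by auto
      then show ?thesis using b True unfolding mate_def by simp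
    next
      case False
      then show ?thesis using b unfolding mate_def by simp
    qed
    moreover have "1 \<le> mate j"
      using b unfolding mate_def by (auto elim: evenE)
    moreover have "odd (i + mate j + k)"
      using 3(1) b even_mate[of j] by auto
    moreover have "to_odd v = (i, mate j, k)"
      using 3 unfolding v by auto
    ultimately show ?thesis
      using b unfolding CS_odd_def CS_verts_def by simp
  qed
qed

lemma to_odd_fiber:
  assumes "u \<in> CS_verts n" "v \<in> CS_verts n" "to_odd u = to_odd v" "u \<noteq> v"
  shows "{u, v} \<in> CS_edges n"
proof -
  obtain i j k i' j' k' where uv: "u = (i, j, k)" "v = (i', j', k')" by (metis prod_cases3)
  have pos: "j > 0" "k > 0" "j' > 0" "k' > 0" "j \<le> i" "j' \<le> i'"
    using assms(1,2) unfolding uv CS_verts_def by auto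
  \<comment> \<open>If both sums are even and the moves are alike, \<open>mate_mate\<close> gives
    \<open>u = v\<close>. If one vertex moves in \<open>k\<close> and the other in \<open>j\<close>,
    the latter has second coordinate \<open>mate i = i + 1\<close> with \<open>i\<close> odd, which
    exceeds its bound. So exactly one vertex moves.\<close>
  have "i = i' \<and> (j = j' \<and> k' = mate k \<or> k = k' \<and> j' = mate j)"
    using assms(3,4) pos mate_mate unfolding uv
    by (auto split: if_splits simp: mate_def)
  then show ?thesis
    using assms(1,2) CS_edge_mate_j CS_edge_mate_k unfolding uv by auto
qed

lemma independence_number_CS:
  "independence_number (CS_verts n) (CS_edges n) = card (CS_odd n)"
proof (rule independence_number_eqI[OF finite_CS_verts _ indep_CS_odd])
  show sub: "CS_odd n \<subseteq> CS_verts n" unfolding CS_odd_def by auto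
  fix S assume "S \<subseteq> CS_verts n" "indep S (CS_edges n)"
  then show "card S \<le> card (CS_odd n)"
    using card_indep_le[of "CS_odd n" to_odd "CS_verts n" "CS_edges n" S]
      to_odd_in_CS_odd to_odd_fiber finite_subset[OF sub finite_CS_verts] by blast
qed

lemma card_odd_shift:
  "card {k \<in> {1..b::nat}. odd (c + k)} = (if even c then (b + 1) div 2 else b div 2)"
proof -
  define A where "A b = {k \<in> {1..b}. odd (c + k)}" for b
  have A: "finite (A b)" "Suc b \<notin> A b" "A 0 = {}" for b
    unfolding A_def by auto
  have A_Suc: "A (Suc b) = (if odd (c + Suc b) then insert (Suc b) (A b) else A b)" for b
    unfolding A_def by (auto simp: le_Suc_eq)
  have "card (A b) = (if even c then (b + 1) div 2 else b div 2)"
    by (induction b) (auto simp: A A_Suc)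
  then show ?thesis
    unfolding A_def .
qed

text \<open>A checkerboard count, doubled to avoid halves. The colours differ in number only if both
  sides are odd; then the colour of the corner (1, 1), whose sum has the parity of \<open>c\<close>,
  has one cell more.\<close>

lemma card_odd_grid:
  "2 * card {(j, k) \<in> {1..a::nat} \<times> {1..b::nat}. odd (c + j + k)} =
    (if even a \<or> even b then a * b else if odd c then a * b + 1 else a * b - 1)"
proof -
  have "{(j, k) \<in> {1..a} \<times> {1..b}. odd (c + j + k)} =
      (SIGMA j:{1..a}. {k \<in> {1..b}. odd (c + j + k)})" by auto
  then have "card {(j, k) \<in> {1..a} \<times> {1..b}. odd (c + j + k)} =
      (\<Sum>j = 1..a. card {k \<in> {1..b}. odd (c + j + k)})"
    by (subst card_SigmaI[symmetric]) auto
  also have "\<dots> = (\<Sum>j = 1..a. if even (c + j) then (b + 1) div 2 else b div 2)"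
    unfolding card_odd_shift ..
  also have "2 * \<dots> =
      (if even a \<or> even b then a * b else if odd c then a * b + 1 else a * b - 1)"
  proof (induction a)
    case (Suc a)
    \<comment> \<open>This and the bound on \<open>b\<close> below control the truncated
      subtractions.\<close>
    have "odd a \<Longrightarrow> a * b > 0 \<or> b = 0" by (auto elim: oddE)
    moreover have "2 * (if even c then (b + 1) div 2 else b div 2) =
        (if even b then b else if even c then b + 1 else b - 1)" for c
      by (simp add: odd_pos)
    moreover have "odd b \<Longrightarrow> 1 \<le> b"
      by (auto elim: oddE)
    ultimately show ?case
      using Suc by (auto simp: distrib_left)
  qed simp
  finally show ?thesis .
qed

text \<open>Both sides \<open>i\<close> and \<open>n - 1 - i\<close> are odd exactly when
  \<open>n\<close> and \<open>i\<close> are odd. Then the grid offset \<open>i\<close> is odd, so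
  the surplus is always \<open>+ 1\<close>.\<close>

lemma card_CS_odd:
  "2 * card (CS_odd n) =
    (\<Sum>i = 1..n - 2. i * (n - 1 - i) + (if odd n \<and> odd i then 1 else 0))"
proof -
  have "CS_odd n =
      (SIGMA i:{1..n - 2}. {(j, k) \<in> {1..i} \<times> {1..n - 1 - i}. odd (i + j + k)})"
    unfolding CS_odd_def CS_verts_Sigma by auto
  moreover have "finite {(j, k) \<in> {1..i} \<times> {1..n - 1 - i}. odd (i + j + k)}" for i
    by (rule finite_subset[of _ "{1..i} \<times> {1..n - 1 - i}"]) auto
  ultimately have "2 * card (CS_odd n) =
      (\<Sum>i = 1..n - 2. 2 * card {(j, k) \<in> {1..i} \<times> {1..n - 1 - i}. odd (i + j + k)})"
    by (simp add: sum_distrib_left)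
  also have "\<dots> = (\<Sum>i = 1..n - 2. i * (n - 1 - i) + (if odd n \<and> odd i then 1 else 0))"
    unfolding card_odd_grid by (rule sum.cong) auto
  finally show ?thesis .
qed

text \<open>Keeping \<open>c\<close> apart from \<open>N\<close> leaves it fixed in the induction;
  it is used with \<open>c = N + 1\<close>.\<close>

lemma sum_mult_diff:
  "(\<Sum>i = 1..N. real i * (c - real i)) =
    c * (real N * (real N + 1) / 2) - real N * (real N + 1) * (2 * real N + 1) / 6"
  by (induction N) (auto simp: field_simps)

lemma sum_odd_indicator: "(\<Sum>i = 1..N. if odd i then 1 else 0) = (N + 1) div (2::nat)"
  by (induction N) auto

theorem theorem6:
  fixes n :: nat
  assumes "n \<ge> 3"
  shows "real (independence_number (CS_verts n) (CS_edges n)) =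
    (if even n then (real n ^ 3 - 3 * real n ^ 2 + 2 * real n) / 12
     else (real n ^ 3 - 3 * real n ^ 2 + 5 * real n - 3) / 12)"
proof -
  \<comment> \<open>Writing \<open>n = m + 2\<close> turns \<open>n - 2\<close> and
    \<open>n - 1\<close> into \<open>m\<close> and \<open>m + 1\<close>.\<close>
  obtain m where n: "n = m + 2"
    using assms that[of "n - 2"] by linarith
  have "2 * card (CS_odd n) =
      (\<Sum>i = 1..m. i * (m + 1 - i)) + (if odd n then (m + 1) div 2 else 0)"
    using card_CS_odd[of n] sum_odd_indicator[of m] by (simp add: n sum.distrib)
  then have "2 * real (card (CS_odd n)) =
      real (\<Sum>i = 1..m. i * (m + 1 - i)) + real (if odd n then (m + 1) div 2 else 0)"
    by (metis of_nat_add of_nat_mult of_nat_numeral)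
  moreover have "real (\<Sum>i = 1..m. i * (m + 1 - i)) =
      (\<Sum>i = 1..m. real i * ((real m + 1) - real i))"
    unfolding of_nat_sum by (rule sum.cong) (auto simp: of_nat_diff)
  \<comment> \<open>For odd \<open>n\<close> also \<open>m\<close> is odd, so the division by 2 is
    exact.\<close>
  moreover have "real (if odd n then (m + 1) div 2 else 0) =
      (if odd n then (real m + 1) / 2 else 0)"
    unfolding n by (auto elim!: oddE)
  ultimately have "2 * real (card (CS_odd n)) =
      (real m + 1) * (real m * (real m + 1) / 2) - real m * (real m + 1) * (2 * real m + 1) / 6
      + (if odd n then (real m + 1) / 2 else 0)"
    by (simp only: sum_mult_diff)
  then show ?thesis
    unfolding independence_number_CS n
    by (auto simp: field_simps power2_eq_square power3_eq_cube split: if_splits)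
qed

end
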